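(* Let $y$ be a random vector in $\mathbb{R}^n$ with mean $\mu$ whose components are homoscedastic and mutually uncorrelated, i.e. $\operatorname{cov}(y)=\sigma^2 I_{n\times n}$. Let $S$ and $L$ be fixed real symmetric $n\times n$ matrices ($S^T=S$, $L^T=L$), and consider the two linear smoothers $\hat\mu^S(y)=Sy$ and $\hat\mu^L(y)=Ly$. Suppose that $\hat\mu^S$ is nested in $\hat\mu^L$ in the wide sense over convex sets, with respect to the squared-error criterion. Then $\hat\mu^L$ has at least as much optimism as $\hat\mu^S$: $$\omega_L\ \ge\ \omega_S .$$
   Context: A modeling approach is a map $\mathbb{R}^n\to\mathbb{R}^n$, $y\mapsto\hat\mu(y)$, from a training vector $y$ to a fitted model $\hat\mu$. The squared-error criterion is $\mathcal{E}(\tilde\mu,y)=\frac1n\sum_{i=1}^n(\tilde\mu_i-y_i)^2$. Wide-sense nesting over convex sets: there is a family $\mathcal{Q}$ of convex subsets of $\mathbb{R}^n$ that is nested (totally ordered by inclusion) such that, for every value $y\in\mathbb{R}^n$, there exist sets $Q_S(y),Q_L(y)\in\mathcal{Q}$ (possibly depending on $y$) with $Q_S(y)\subseteq Q_L(y)$ and $$\hat\mu^S(y)=\operatorname*{arg\,min}_{\tilde\mu\in Q_S(y)}\mathcal{E}(\tilde\mu,y),\qquad \hat\mu^L(y)=\operatorname*{arg\,min}_{\tilde\mu\in Q_L(y)}\mathcal{E}(\tilde\mu,y).$$ (In particular these minimizers exist for every $y$.) The (expected) optimism of a modeling approach $\hat\mu$ is $$\omega=\frac1n\Bigl(\mathbb{E}\|\hat\mu(y)-y^{\mathrm{new}}\|_2^2-\mathbb{E}\|\hat\mu(y)-y\|_2^2\Bigr),$$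 where $y^{\mathrm{new}}$ is independent of $y$ and has the same distribution as $y$. Equivalently, $\omega=\frac2n\sum_{i=1}^n\operatorname{cov}(\hat\mu_i(y),y_i)$. $\omega_S$ and $\omega_L$ denote the optimism of $\hat\mu^S$ and $\hat\mu^L$. *)

theory Defs
  imports "HOL-Analysis.Analysis" "HOL-Probability.Probability"
begin

type_synonym 'n modeling_approach = "real ^ 'n \<Rightarrow> real ^ 'n"

definition squared_error :: "real ^ 'n \<Rightarrow> real ^ 'n \<Rightarrow> real"
  where "squared_error m y = (1 / real CARD('n)) * (\<Sum>i\<in>UNIV. (m $ i - y $ i)\<^sup>2)"

text \<open>
  The family \<open>Q\<close> does not depend on the training vector; the members selected from it may.
  For the squared error a minimizer over a convex set is unique, so that being a minimizer
  over such a set is the same as being the arg min.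
\<close>

definition nested_wide_convex ::
    "(real ^ 'n \<Rightarrow> real ^ 'n \<Rightarrow> real) \<Rightarrow> 'n modeling_approach \<Rightarrow> 'n modeling_approach \<Rightarrow> bool"
  where "nested_wide_convex crit f g \<longleftrightarrow>
    (\<exists>Q :: (real ^ 'n) set set.
       (\<forall>A\<in>Q. convex A) \<and> chain_subset Q \<and>
       (\<forall>y. \<exists>QS\<in>Q. \<exists>QL\<in>Q. QS \<subseteq> QL \<and>
          is_arg_min (\<lambda>m. crit m y) (\<lambda>m. m \<in> QS) (f y) \<and>
          is_arg_min (\<lambda>m. crit m y) (\<lambda>m. m \<in> QL) (g y)))"

definition covariance :: "'a measure \<Rightarrow> ('a \<Rightarrow> real) \<Rightarrow> ('a \<Rightarrow> real) \<Rightarrow> real"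
  where "covariance M X Y =
    (LINT w|M. (X w - (LINT v|M. X v)) * (Y w - (LINT v|M. Y v)))"

definition covariance_matrix :: "'a measure \<Rightarrow> ('a \<Rightarrow> real ^ 'n) \<Rightarrow> real ^ 'n ^ 'n"
  where "covariance_matrix M y = (\<chi> i j. covariance M (\<lambda>w. y w $ i) (\<lambda>w. y w $ j))"

definition independent_copy ::
    "'a measure \<Rightarrow> ('a \<Rightarrow> real ^ 'n) \<Rightarrow> ('a \<Rightarrow> real ^ 'n) \<Rightarrow> bool"
  where "independent_copy M y y' \<longleftrightarrow>
    prob_space.indep_var M borel y borel y' \<and> distr M borel y' = distr M borel y"

definition optimism ::
    "'a measure \<Rightarrow> ('a \<Rightarrow> real ^ 'n) \<Rightarrow> ('a \<Rightarrow> real ^ 'n) \<Rightarrow> 'n modeling_approach \<Rightarrow> real"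
  where "optimism M y ynew f = (1 / real CARD('n)) *
    ((LINT w|M. (norm (f (y w) - ynew w))\<^sup>2) - (LINT w|M. (norm (f (y w) - y w))\<^sup>2))"

end

theory Submission
  imports Defs
begin

text \<open>
  For a linear smoother \<open>A\<close> and uncorrelated homoscedastic components the optimism is
  \<open>2 \<sigma>\<^sup>2 tr A / n\<close> (\<open>optimism_linear\<close>), so the claim is that \<open>tr S \<le> tr L\<close>.

  Nesting enters through the obtuse-angle criterion for a minimizer \<open>p\<close> of the distance
  to \<open>y\<close> over a convex set: \<open>y - p\<close> makes no acute angle with \<open>z - p\<close> for any
  \<open>z\<close> in the set (\<open>squared_error_arg_min_obtuse\<close>). It is used twice.

  \<^item> For one \<open>y\<close>, the fit \<open>S y\<close> lies in the set over which \<open>L y\<close> is the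
    minimizer, so \<open>(y - L y) \<bullet> (S y - L y) \<le> 0\<close>.
  \<^item> The sets selected for \<open>y\<close> and for \<open>- y\<close> are comparable, because the family is
    totally ordered. So the larger one contains both fits \<open>A y\<close> and \<open>- A y\<close>, and
    the criterion gives \<open>\<parallel>A y\<parallel>\<^sup>2 \<le> y \<bullet> A y\<close> for \<open>A = S\<close> and for
    \<open>A = L\<close> (\<open>linear_arg_min_firmly_nonexpansive\<close>). In particular no eigenvalue
    exceeds 1.

  The first inequality does not say that \<open>L - S\<close> is positive semidefinite, but for a unit
  eigenvector \<open>b\<close> of \<open>L\<close> with eigenvalue \<open>l\<close> it reads
  \<open>(1 - l) (b \<bullet> S b - l) \<le> 0\<close>. If \<open>l < 1\<close>, then \<open>b \<bullet> S b \<le> l\<close>. If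
  \<open>l = 1\<close>, then \<open>b \<bullet> S b \<le> 1\<close> follows from the second inequality for \<open>S\<close>. The sum
  of \<open>b \<bullet> S b \<le> b \<bullet> L b\<close> over an orthonormal eigenbasis of \<open>L\<close> compares the
  traces (\<open>trace_mono_of_obtuse\<close>).
\<close>

section \<open>Minimizers of the squared error over convex sets\<close>

lemma squared_error_eq_dist: "squared_error m y = (dist m y)\<^sup>2 / real CARD('n)"
  for m y :: "real ^ 'n"
  by (simp add: squared_error_def dist_norm norm_vec_def L2_set_def sum_nonneg)

lemma squared_error_less_iff: "squared_error p y < squared_error q y \<longleftrightarrow> dist p y < dist q y"
  for p q y :: "real ^ 'n"
  by (simp add: squared_error_eq_dist divide_less_cancel) (meson pos2 power_less_imp_less_base power_strict_mono zero_le_dist)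

text \<open>
  If the angle were acute, a short step from \<open>p\<close> towards \<open>z\<close> would stay in the convex
  set and come closer to \<open>y\<close>.
\<close>

lemma squared_error_arg_min_obtuse:
  fixes y p z :: "real ^ 'n"
  assumes "convex A" and p: "is_arg_min (\<lambda>m. squared_error m y) (\<lambda>m. m \<in> A) p" and "z \<in> A"
  shows "(y - p) \<bullet> (z - p) \<le> 0"
proof (rule ccontr)
  assume "\<not> ?thesis"
  then obtain u where u: "u > 0" "u \<le> 1" "dist (p + u *\<^sub>R (z - p)) y < dist p y"
    using closer_point_lemma[of y p z] by auto
  have "p \<in> A"
    using p by (simp add: is_arg_min_def)
  have "p + u *\<^sub>R (z - p) = (1 - u) *\<^sub>R p + u *\<^sub>R z"
    by (simp add: algebra_simps)
  also have "\<dots> \<in> A"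
    using \<open>convex A\<close> \<open>p \<in> A\<close> \<open>z \<in> A\<close> u by (intro convexD) auto
  finally show False
    using p u(3) by (auto simp: is_arg_min_def squared_error_less_iff)
qed

text \<open>
  Each training vector has its own constraint set, so different fits can only be related through
  the inclusion order. Opposite training vectors suffice: whichever of their two sets is the
  larger contains two opposite fits, and its own minimizer then makes no acute angle with the
  chord between them.
\<close>

lemma linear_arg_min_firmly_nonexpansive:
  fixes A :: "real ^ 'n ^ 'n"
  assumes convex: "\<And>B. B \<in> Q \<Longrightarrow> convex B" and chain: "chain_subset Q"
    and min: "\<And>y. \<exists>B\<in>Q. is_arg_min (\<lambda>m. squared_error m y) (\<lambda>m. m \<in> B) (A *v y)"
  shows "(A *v y) \<bullet> (A *v y) \<le> y \<bullet> (A *v y)"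
proof -
  have minus: "A *v (- x) = - (A *v x)" for x
    by (metis matrix_vector_mul_linear linear_neg)
  \<comment> \<open>\<open>B\<close> belongs to \<open>x\<close> and is the larger set; \<open>x\<close> is \<open>y\<close> or \<open>- y\<close>.\<close>
  have *: "(A *v x) \<bullet> (A *v x) \<le> x \<bullet> (A *v x)"
    if "B \<in> Q" "C \<subseteq> B" "is_arg_min (\<lambda>m. squared_error m x) (\<lambda>m. m \<in> B) (A *v x)"
      "is_arg_min (\<lambda>m. squared_error m (- x)) (\<lambda>m. m \<in> C) (A *v (- x))" for x B C
  proof -
    have "- (A *v x) \<in> B"
      using that(2,4) by (auto simp: is_arg_min_def minus)
    then have "(x - A *v x) \<bullet> (- (A *v x) - A *v x) \<le> 0"
      by (rule squared_error_arg_min_obtuse[OF convex[OF that(1)] that(3)])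
    then show ?thesis
      by (simp only: inner_diff_left inner_diff_right inner_minus_right)
  qed
  obtain B where B: "B \<in> Q" "is_arg_min (\<lambda>m. squared_error m y) (\<lambda>m. m \<in> B) (A *v y)"
    using min by blast
  obtain C where C: "C \<in> Q" "is_arg_min (\<lambda>m. squared_error m (- y)) (\<lambda>m. m \<in> C) (A *v (- y))"
    using min by blast
  have "C \<subseteq> B \<or> B \<subseteq> C"
    using chain B(1) C(1) by (auto simp: chain_subset_def)
  then show ?thesis
  proof
    assume "C \<subseteq> B"
    then show ?thesis using * B C by blast
  next
    assume "B \<subseteq> C"
    then show ?thesis using *[of C B "- y"] B C by (simp add: minus)
  qed
qed

section \<open>Orthonormal eigenbases\<close>

text \<open>
  A maximizer \<open>v\<close> of the quadratic form on the unit sphere of \<open>V\<close>, with value \<open>l\<close>,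
  is a zero of the form \<open>q x = l (x \<bullet> x) - x \<bullet> f x\<close>, which is nonnegative on \<open>V\<close>. A
  nonnegative quadratic form has zero derivative at its zeros, and the gradient of
  \<open>q\<close> at \<open>v\<close> is \<open>2 (l v - f v)\<close>.
\<close>

lemma self_adjoint_eigenvector_exists:
  fixes f :: "'a::euclidean_space \<Rightarrow> 'a"
  assumes "subspace V" "linear f" and inv: "\<And>x. x \<in> V \<Longrightarrow> f x \<in> V"
    and sa: "\<And>x y. x \<in> V \<Longrightarrow> y \<in> V \<Longrightarrow> x \<bullet> f y = f x \<bullet> y"
    and "V \<noteq> {0}"
  shows "\<exists>v l. v \<in> V \<and> norm v = 1 \<and> f v = l *\<^sub>R v"
proof -
  interpret f: linear f by fact
  let ?K = "sphere 0 1 \<inter> V"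
  obtain u where u: "u \<in> V" "u \<noteq> 0"
    using assms(1,5) subspace_0 by blast
  then have "u /\<^sub>R norm u \<in> ?K"
    using assms(1) by (auto intro: subspace_scale)
  moreover have "compact ?K"
    using closed_subspace[OF assms(1)] by (intro compact_Int_closed) auto
  moreover have "continuous_on ?K (\<lambda>x. x \<bullet> f x)"
    using linear_continuous_on[of f] assms(2) by (intro continuous_intros) (simp add: linear_conv_bounded_linear)
  ultimately obtain v where v: "v \<in> ?K" and max: "\<And>x. x \<in> ?K \<Longrightarrow> x \<bullet> f x \<le> v \<bullet> f v"
    using continuous_attains_sup[of ?K "\<lambda>x. x \<bullet> f x"] by blast
  define l where "l = v \<bullet> f v"
  define q where "q x = l * (x \<bullet> x) - x \<bullet> f x" for x
  have vv: "v \<bullet> v = 1" and "v \<in> V"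
    using v by (auto simp: norm_eq_1)
  have q_nonneg: "q x \<ge> 0" if "x \<in> V" for x
  proof (cases "x = 0")
    case True
    then show ?thesis by (simp add: q_def)
  next
    case False
    then have "x /\<^sub>R norm x \<in> ?K"
      using assms(1) that by (auto intro: subspace_scale)
    from max[OF this] have "(x \<bullet> f x) / (norm x)\<^sup>2 \<le> l"
      by (simp add: f.scale l_def power2_eq_square divide_simps)
    then show ?thesis
      using False by (simp add: q_def divide_simps power2_norm_eq_inner)
  qed
  define w where "w = l *\<^sub>R v - f v"
  have "w \<in> V"
    using assms(1) \<open>v \<in> V\<close> inv by (auto simp: w_def intro: subspace_diff subspace_scale)
  have q_line: "q (v + t *\<^sub>R w) = 2 * t * (w \<bullet> w) + t\<^sup>2 * q w" for t
  proof -
    have "w \<bullet> f v = f w \<bullet> v"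
      using sa \<open>v \<in> V\<close> \<open>w \<in> V\<close> by blast
    then have wv: "v \<bullet> f w = w \<bullet> f v"
      by (simp add: inner_commute)
    have ww: "w \<bullet> w = l * (v \<bullet> w) - w \<bullet> f v"
      by (subst (1) w_def) (simp only: inner_diff_left inner_scaleR_left inner_commute[of w "f v"])
    have "q (v + t *\<^sub>R w) = 2 * t * (l * (v \<bullet> w) - w \<bullet> f v) + t\<^sup>2 * q w"
      by (simp add: q_def f.add f.scale inner_add_left inner_add_right wv vv l_def[symmetric]
          inner_commute[of w v] power2_eq_square algebra_simps)
    then show ?thesis
      by (simp only: ww)
  qed
  have "w \<bullet> w = 0"
  proof (rule ccontr)
    assume "w \<bullet> w \<noteq> 0"
    then have pos: "w \<bullet> w > 0" by simp
    \<comment> \<open>A step from \<open>v\<close> against the gradient, short enough that the linear term of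
      \<open>q_line\<close> dominates, makes \<open>q\<close> negative.\<close>
    define s where "s = 1 / (1 + q w)"
    have "s > 0" "s * q w \<le> 1"
      using q_nonneg[OF \<open>w \<in> V\<close>] by (simp_all add: s_def)
    have "v + (- (s * (w \<bullet> w))) *\<^sub>R w \<in> V"
      using assms(1) \<open>v \<in> V\<close> \<open>w \<in> V\<close> by (intro subspace_add subspace_scale)
    then have "0 \<le> 2 * (- (s * (w \<bullet> w))) * (w \<bullet> w) + (- (s * (w \<bullet> w)))\<^sup>2 * q w"
      using q_nonneg q_line by metis
    also have "\<dots> = s * (w \<bullet> w)\<^sup>2 * (s * q w - 2)"
      by (simp add: algebra_simps power2_eq_square)
    also have "\<dots> < 0"
      using \<open>s > 0\<close> \<open>s * q w \<le> 1\<close> pos by (intro mult_pos_neg) auto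
    finally show False by simp
  qed
  then have "f v = l *\<^sub>R v"
    by (simp add: w_def)
  then show ?thesis
    using v by auto
qed

text \<open>
  The spectral theorem, stated for invariant subspaces so that the induction on the dimension
  can pass to the orthogonal complement of one eigenvector.
\<close>

lemma self_adjoint_orthonormal_eigenbasis_subspace:
  fixes f :: "'a::euclidean_space \<Rightarrow> 'a"
  assumes "subspace V" "linear f" and "\<And>x. x \<in> V \<Longrightarrow> f x \<in> V"
    and "\<And>x y. x \<in> V \<Longrightarrow> y \<in> V \<Longrightarrow> x \<bullet> f y = f x \<bullet> y"
  shows "\<exists>B. pairwise orthogonal B \<and> (\<forall>b\<in>B. norm b = 1 \<and> (\<exists>l. f b = l *\<^sub>R b)) \<and> span B = V"
  using assms
proof (induction "dim V" arbitrary: V)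
  case 0
  then have "V = {0}"
    using subspace_0 by fastforce
  then show ?case
    by (intro exI[of _ "{}"]) auto
next
  case (Suc k)
  have "V \<noteq> {0}"
    using Suc.hyps(2) by auto
  then obtain v l where v: "v \<in> V" "norm v = 1" "f v = l *\<^sub>R v"
    using self_adjoint_eigenvector_exists[OF Suc.prems] by blast
  define W where "W = {y \<in> V. \<forall>x \<in> span {v}. orthogonal x y}"
  have W_iff: "y \<in> W \<longleftrightarrow> y \<in> V \<and> v \<bullet> y = 0" for y
    by (auto simp: W_def span_singleton orthogonal_def)
  have "span {v} \<subseteq> V"
    using Suc.prems(1) v(1) by (simp add: span_minimal)
  then have "dim W + dim (span {v}) = dim V"
    using dim_subspace_orthogonal_to_vectors[OF subspace_span Suc.prems(1), of "{v}"] by (simp only: W_def)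
  moreover have "dim (span {v}) = 1"
    using v(2) by (auto simp: dim_singleton)
  ultimately have "k = dim W"
    using Suc.hyps(2) by simp
  moreover have "subspace W"
    using Suc.prems(1) by (auto simp: subspace_def W_iff inner_add_right)
  moreover have "f x \<in> W" if "x \<in> W" for x
  proof -
    have "v \<bullet> f x = l * (v \<bullet> x)"
      using that v Suc.prems(4)[of v x] by (simp add: W_iff)
    then show ?thesis
      using that Suc.prems(3) by (simp add: W_iff)
  qed
  ultimately obtain B where B: "pairwise orthogonal B" "span B = W"
      "\<And>b. b \<in> B \<Longrightarrow> norm b = 1 \<and> (\<exists>l. f b = l *\<^sub>R b)"
    using Suc.hyps(1)[of W] Suc.prems(2,4) by (auto simp: W_iff)
  have perp: "v \<bullet> b = 0" if "b \<in> B" for b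
    using that B(2) W_iff span_base by blast
  have "pairwise orthogonal (insert v B)"
    using B(1) perp by (auto simp: pairwise_insert orthogonal_def inner_commute)
  moreover have "span (insert v B) = V"
  proof
    show "span (insert v B) \<subseteq> V"
      using v(1) B(2) W_iff span_superset[of B] Suc.prems(1) by (intro span_minimal) auto
    show "V \<subseteq> span (insert v B)"
    proof
      fix x assume "x \<in> V"
      then have "x - (v \<bullet> x) *\<^sub>R v \<in> W"
        using v Suc.prems(1)
        by (auto simp: W_iff inner_diff_right norm_eq_1 intro: subspace_diff subspace_scale)
      then show "x \<in> span (insert v B)"
        by (auto simp: span_insert B(2))
    qed
  qed
  ultimately show ?case
    using B(3) v(2,3) by (intro exI[of _ "insert v B"]) auto
qed

lemma symmetric_matrix_orthonormal_eigenbasis: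
  fixes A :: "real ^ 'n ^ 'n"
  assumes "transpose A = A"
  obtains B where "finite B" "pairwise orthogonal B" "\<And>b. b \<in> B \<Longrightarrow> norm b = 1"
    "span B = UNIV" "\<And>b. b \<in> B \<Longrightarrow> \<exists>l. A *v b = l *\<^sub>R b"
proof -
  have "x \<bullet> (A *v y) = (A *v x) \<bullet> y" for x y
    using assms by (metis dot_lmul_matrix transpose_matrix_vector)
  then obtain B where "pairwise orthogonal B" "span B = UNIV"
      "\<forall>b\<in>B. norm b = 1 \<and> (\<exists>l. A *v b = l *\<^sub>R b)"
    using self_adjoint_orthonormal_eigenbasis_subspace[of UNIV "(*v) A"] by auto
  then show ?thesis
    using that pairwise_orthogonal_imp_finite by blast
qed

section \<open>Comparison of traces\<close>

lemma trace_orthonormal_basis: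
  fixes A :: "real ^ 'n ^ 'n"
  assumes B: "finite B" "pairwise orthogonal B" "\<And>b. b \<in> B \<Longrightarrow> norm b = 1" "span B = UNIV"
  shows "trace A = (\<Sum>b\<in>B. b \<bullet> (A *v b))"
proof -
  have expand: "(\<Sum>b\<in>B. (x \<bullet> b) *\<^sub>R b) = x" for x
    using B by (intro orthonormal_basis_expand) auto
  \<comment> \<open>The entries of \<open>U U\<^sup>T\<close>, where the columns of the orthogonal matrix \<open>U\<close> are
    the basis vectors.\<close>
  have parseval: "(\<Sum>b\<in>B. b $ i * b $ j) = (if i = j then 1 else 0)" for i j :: 'n
    using arg_cong[OF expand[of "axis i 1"], of "\<lambda>x. x $ j"]
    by (simp only: inner_axis' sum_component vector_scaleR_component) (simp add: axis_def)
  have "(\<Sum>b\<in>B. b \<bullet> (A *v b)) = (\<Sum>b\<in>B. \<Sum>i\<in>UNIV. \<Sum>j\<in>UNIV. A $ i $ j * (b $ i * b $ j))"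
    by (simp add: inner_vec_def matrix_vector_mult_def sum_distrib_left mult_ac)
  also have "\<dots> = (\<Sum>i\<in>UNIV. \<Sum>j\<in>UNIV. A $ i $ j * (\<Sum>b\<in>B. b $ i * b $ j))"
    by (subst sum.swap, rule sum.cong[OF refl], subst sum.swap) (simp add: sum_distrib_left)
  also have "\<dots> = trace A"
    by (simp add: parseval trace_def if_distrib cong: if_cong)
  finally show ?thesis by simp
qed

text \<open>
  On an eigenvector of \<open>L\<close> with eigenvalue \<open>l < 1\<close> the obtuse-angle inequality can be
  divided by \<open>1 - l\<close>. It is void when \<open>l = 1\<close>; there the bound on \<open>S\<close> replaces it.
\<close>

lemma trace_mono_of_obtuse:
  fixes S L :: "real ^ 'n ^ 'n"
  assumes "transpose L = L"
    and S: "\<And>y. (S *v y) \<bullet> (S *v y) \<le> y \<bullet> (S *v y)"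
    and L: "\<And>y. (L *v y) \<bullet> (L *v y) \<le> y \<bullet> (L *v y)"
    and SL: "\<And>y. (y - L *v y) \<bullet> (S *v y - L *v y) \<le> 0"
  shows "trace S \<le> trace L"
proof -
  obtain B where B: "finite B" "pairwise orthogonal B" "\<And>b. b \<in> B \<Longrightarrow> norm b = 1" "span B = UNIV"
    and eig: "\<And>b. b \<in> B \<Longrightarrow> \<exists>l. L *v b = l *\<^sub>R b"
    using symmetric_matrix_orthonormal_eigenbasis[OF assms(1)] by metis
  have "b \<bullet> (S *v b) \<le> b \<bullet> (L *v b)" if b: "b \<in> B" for b
  proof -
    obtain l where l: "L *v b = l *\<^sub>R b"
      using eig b by blast
    have bb: "b \<bullet> b = 1"
      using B(3) b by (simp add: norm_eq_1)
    have "l * l \<le> l"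
      using L[of b] by (simp add: l bb)
    then have "l \<le> 1"
      using mult_strict_right_mono[of 1 l l] by (cases "l > 1") auto
    show ?thesis
    proof (cases "l = 1")
      case False
      have "(b - L *v b) \<bullet> (S *v b - L *v b) = (1 - l) * (b \<bullet> (S *v b) - l)"
        by (simp add: l bb inner_diff_left inner_diff_right algebra_simps)
      with SL[of b] have "(1 - l) * (b \<bullet> (S *v b) - l) \<le> 0"
        by simp
      then show ?thesis
        using False \<open>l \<le> 1\<close> by (simp add: l bb mult_le_0_iff)
    next
      case True
      \<comment> \<open>Together with \<open>\<parallel>S b\<parallel>\<^sup>2 \<le> b \<bullet> S b\<close> this gives
        \<open>b \<bullet> S b \<le> 1\<close>.\<close>
      have "0 \<le> (b - S *v b) \<bullet> (b - S *v b)"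
        by simp
      also have "\<dots> = 1 - 2 * (b \<bullet> (S *v b)) + (S *v b) \<bullet> (S *v b)"
        by (simp add: inner_diff_left inner_diff_right bb inner_commute)
      finally show ?thesis
        using S[of b] True by (simp add: l bb)
    qed
  qed
  then show ?thesis
    by (simp add: trace_orthonormal_basis[OF B] sum_mono)
qed

section \<open>The optimism of a linear smoother\<close>

text \<open>
  Expanding both squares, the terms in \<open>\<parallel>A y\<parallel>\<^sup>2\<close> cancel, and those in the norms of
  \<open>y\<close> and its copy cancel because the two have the same distribution. What remains is twice
  the expectation of \<open>A y \<bullet> y\<close> minus that of \<open>A y \<bullet> y'\<close>, where \<open>y'\<close> is the copy.
  By independence this is the sum of \<open>A\<^sub>i\<^sub>j cov(y\<^sub>j, y\<^sub>i)\<close>, which only sees the diagonal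
  of \<open>A\<close>.
\<close>

lemma (in prob_space) optimism_linear:
  fixes y ynew :: "'a \<Rightarrow> real ^ 'n" and A :: "real ^ 'n ^ 'n"
  assumes y[measurable]: "y \<in> borel_measurable M"
    and y2: "integrable M (\<lambda>w. (norm (y w))\<^sup>2)"
    and cov: "covariance_matrix M y = c *\<^sub>R mat 1"
    and copy: "independent_copy M y ynew"
  shows "optimism M y ynew (\<lambda>v. A *v v) = 2 * c / real CARD('n) * trace A"
proof -
  have indep: "indep_var borel y borel ynew" and distr: "distr M borel ynew = distr M borel y"
    using copy by (auto simp: independent_copy_def)
  have n[measurable]: "ynew \<in> borel_measurable M"
    using indep by (rule indep_var_rv2)
  have transfer: "integrable M (\<lambda>w. g (ynew w)) \<longleftrightarrow> integrable M (\<lambda>w. g (y w))"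
    "(LINT w|M. g (ynew w)) = (LINT w|M. g (y w))"
    if [measurable]: "g \<in> borel_measurable borel" for g :: "real ^ 'n \<Rightarrow> real"
    using integrable_distr_eq[OF n that] integrable_distr_eq[OF y that]
      integral_distr[OF n that] integral_distr[OF y that] distr by auto
  note [measurable] = measurable_compose[OF y borel_measurable_nth]
  have prod: "integrable M (\<lambda>w. y w $ i * y w $ j)" for i j
  proof (rule Bochner_Integration.integrable_bound[OF y2])
    show "AE w in M. norm (y w $ i * y w $ j) \<le> norm ((norm (y w))\<^sup>2)"
      by (auto simp: abs_mult power2_eq_square intro!: mult_mono component_le_norm_cart)
  qed measurable
  have lin: "integrable M (\<lambda>w. y w $ i)" for i
  proof (rule square_integrable_imp_integrable)
    show "integrable M (\<lambda>w. (y w $ i)\<^sup>2)"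
      using prod[of i i] by (simp only: power2_eq_square)
  qed measurable
  have lin': "integrable M (\<lambda>w. ynew w $ i)" for i
    using transfer(1)[of "\<lambda>x. x $ i"] lin by simp
  have ind: "indep_var borel (\<lambda>w. y w $ j) borel (\<lambda>w. ynew w $ i)" for i j
    using indep_var_compose[OF indep, of "\<lambda>x. x $ j" borel "\<lambda>x. x $ i" borel] by (simp add: comp_def)
  have prod': "integrable M (\<lambda>w. y w $ j * ynew w $ i)" for i j
    by (rule indep_var_integrable[OF ind lin lin'])
  have E': "(LINT w|M. y w $ j * ynew w $ i) = (LINT w|M. y w $ j) * (LINT w|M. y w $ i)" for i j
    using indep_var_lebesgue_integral[OF ind lin lin'] transfer(2)[of "\<lambda>x. x $ i"] by simp
  have cov_eq: "(LINT w|M. y w $ j * y w $ i) - (LINT w|M. y w $ j) * (LINT w|M. y w $ i)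
      = (if i = j then c else 0)" for i j
  proof -
    have "covariance M (\<lambda>w. y w $ i) (\<lambda>w. y w $ j) = (if i = j then c else 0)"
      using arg_cong[OF cov, of "\<lambda>X. X $ i $ j"] by (simp add: covariance_matrix_def mat_def)
    moreover have "covariance M (\<lambda>w. y w $ i) (\<lambda>w. y w $ j)
        = (LINT w|M. y w $ j * y w $ i) - (LINT w|M. y w $ j) * (LINT w|M. y w $ i)"
      using prod[of i j] lin
      by (simp add: covariance_def left_diff_distrib right_diff_distrib prob_space mult.commute)
    ultimately show ?thesis by simp
  qed
  have inner_eq: "(B *v v) \<bullet> z = (\<Sum>i\<in>UNIV. \<Sum>j\<in>UNIV. B $ i $ j * (v $ j * z $ i))"
    for B :: "real ^ 'n ^ 'n" and v z
    by (simp add: inner_vec_def matrix_vector_mult_def sum_distrib_right) (simp add: mult_ac)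
  have n2: "integrable M (\<lambda>w. (norm (ynew w))\<^sup>2)"
    using transfer(1)[of "\<lambda>x. (norm x)\<^sup>2"] y2 by simp
  have Ay2: "integrable M (\<lambda>w. (norm (A *v y w))\<^sup>2)"
  proof -
    \<comment> \<open>In this form the square is a combination of the products in \<open>prod\<close>.\<close>
    have "(norm (A *v v))\<^sup>2 = ((transpose A ** A) *v v) \<bullet> v" for v
      by (simp add: power2_norm_eq_inner dot_lmul_matrix transpose_matrix_vector
          flip: matrix_vector_mul_assoc)
    then show ?thesis
      using prod by (simp add: inner_eq)
  qed
  have in1: "integrable M (\<lambda>w. (A *v y w) \<bullet> y w)" and in2: "integrable M (\<lambda>w. (A *v y w) \<bullet> ynew w)"
    using prod prod' by (simp_all add: inner_eq)
  have sq: "(norm (u - z))\<^sup>2 = (norm u)\<^sup>2 + (norm z)\<^sup>2 - 2 * (u \<bullet> z)" for u z :: "real ^ 'n"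
    by (simp add: power2_norm_eq_inner inner_diff_left inner_diff_right inner_commute)
  have "(LINT w|M. (norm (A *v y w - ynew w))\<^sup>2) - (LINT w|M. (norm (A *v y w - y w))\<^sup>2)
      = 2 * ((LINT w|M. (A *v y w) \<bullet> y w) - (LINT w|M. (A *v y w) \<bullet> ynew w))"
    using Ay2 y2 n2 in1 in2 transfer(2)[of "\<lambda>x. (norm x)\<^sup>2"] by (simp add: sq)
  also have "(LINT w|M. (A *v y w) \<bullet> y w) - (LINT w|M. (A *v y w) \<bullet> ynew w)
      = (\<Sum>i\<in>UNIV. \<Sum>j\<in>UNIV. A $ i $ j *
          ((LINT w|M. y w $ j * y w $ i) - (LINT w|M. y w $ j) * (LINT w|M. y w $ i)))"
    unfolding inner_eq using prod prod'
    by (simp add: E' right_diff_distrib sum_subtractf)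
  also have "\<dots> = c * trace A"
    by (simp add: cov_eq trace_def if_distrib sum_distrib_left mult.commute cong: if_cong)
  finally show ?thesis
    by (simp add: optimism_def)
qed

theorem theorem1:
  fixes M :: "'a measure"
    and y ynew :: "'a \<Rightarrow> real ^ 'n"
    and \<mu> :: "real ^ 'n"
    and \<sigma> :: real
    and S L :: "real ^ 'n ^ 'n"
  assumes "prob_space M"
    and "y \<in> borel_measurable M"
    and "integrable M (\<lambda>w. (norm (y w))\<^sup>2)"
    and "(LINT w|M. y w) = \<mu>"
    and "covariance_matrix M y = \<sigma>\<^sup>2 *\<^sub>R mat 1"
    and "independent_copy M y ynew"
    and "transpose S = S"
    and "transpose L = L"
    and "nested_wide_convex squared_error (\<lambda>v. S *v v) (\<lambda>v. L *v v)"
  shows "optimism M y ynew (\<lambda>v. L *v v) \<ge> optimism M y ynew (\<lambda>v. S *v v)"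
proof -
  interpret prob_space M by fact
  obtain Q where Q: "\<And>A. A \<in> Q \<Longrightarrow> convex A" "chain_subset Q"
    and min: "\<And>v. \<exists>QS\<in>Q. \<exists>QL\<in>Q. QS \<subseteq> QL \<and>
          is_arg_min (\<lambda>m. squared_error m v) (\<lambda>m. m \<in> QS) (S *v v) \<and>
          is_arg_min (\<lambda>m. squared_error m v) (\<lambda>m. m \<in> QL) (L *v v)"
    using assms(9) unfolding nested_wide_convex_def by blast
  have "(v - L *v v) \<bullet> (S *v v - L *v v) \<le> 0" for v
  proof -
    obtain QS QL where *: "QL \<in> Q" "QS \<subseteq> QL"
      "is_arg_min (\<lambda>m. squared_error m v) (\<lambda>m. m \<in> QS) (S *v v)"
      "is_arg_min (\<lambda>m. squared_error m v) (\<lambda>m. m \<in> QL) (L *v v)"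
      using min by blast
    then have "S *v v \<in> QL"
      by (auto simp: is_arg_min_def)
    then show ?thesis
      using squared_error_arg_min_obtuse[OF Q(1)] * by blast
  qed
  moreover have "(S *v v) \<bullet> (S *v v) \<le> v \<bullet> (S *v v)" "(L *v v) \<bullet> (L *v v) \<le> v \<bullet> (L *v v)" for v
    by (rule linear_arg_min_firmly_nonexpansive[OF Q]; use min in meson)+
  ultimately have "trace S \<le> trace L"
    using assms(8) by (intro trace_mono_of_obtuse)
  then show ?thesis
    by (simp add: optimism_linear[OF assms(2,3,5,6)] divide_right_mono mult_left_mono)
qed

end
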